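(* Let $\Phi_1,\Phi_2 : M_n\to M_n$ be Hermiticity-preserving linear maps that are positive but not completely positive. If $J(\Phi_1)$ is finer than $J(\Phi_2)$, then $\nu(\Phi_1)\geq\nu(\Phi_2)$.
   Context: $M_n$ is the set of $n\times n$ complex matrices. A density matrix is a positive semidefinite matrix with trace $1$. $A\succeq O$ means that $A$ is positive semidefinite. The support of a Hermitian matrix is its range. A linear map on $M_n$ is Hermiticity-preserving if it sends Hermitian matrices to Hermitian matrices, positive if it sends positive semidefinite matrices to positive semidefinite matrices, and completely positive if $I_m\otimes\Phi$ (the identity map on $M_m$ tensored with $\Phi$) is positive for all $m\geq 1$. The Choi matrix of $\Phi$ is $J(\Phi)=\sum_{i,j=1}^n E_{i,j}\otimes\Phi(E_{i,j})\in M_n\otimes M_n$, where $E_{i,j}$ are the standard matrix units. The Choi matrix of a positive, not completely positive map is called an entanglement witness. For entanglement witnesses $W_1,W_2\in M_n\otimes M_n$, $W_1$ is finer than $W_2$ if $\mathrm{Tr}(W_1\rho)<0$ for every density matrix $\rho\in M_n\otimes M_n$ with $\mathrm{Tr}(W_2\rho)<0$. For a Hermiticity-preserving linear map $\Phi$ on $M_n$, $\nu_m(\Phi)$ is the maximum of $\dim(\mathcal{S})$ over all subspaces $\mathcal{S}\subseteq\mathbb{C}^m\otimes\mathbb{C}^n$ such that $(I_m\otimes\Phi)(\rho)\not\succeq O$ for every density matrix $\rho\in M_m\otimes M_n$ with support contained in $\mathcal{S}$; and $\nu(\Phi)=\lim_{m\to\infty}\nu_m(\Phi)/m$ (this limit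 always exists). *)

theory Defs
  imports Complex_Main "Jordan_Normal_Form.Schur_Decomposition" "Jordan_Normal_Form.VS_Connect"
begin

(* Orders on complex numbers are those of Complex_Order: 0 \<le> z and z < 0 include Im z = 0. *)

definition hermitian_mat :: "complex mat \<Rightarrow> bool" where
  "hermitian_mat A \<longleftrightarrow> square_mat A \<and> mat_adjoint A = A"

definition psd :: "complex mat \<Rightarrow> bool" where
  "psd A \<longleftrightarrow> hermitian_mat A \<and> (\<forall>v \<in> carrier_vec (dim_row A). 0 \<le> (A *\<^sub>v v) \<bullet>c v)"

definition mat_trace :: "complex mat \<Rightarrow> complex" where
  "mat_trace A = (\<Sum>i<dim_row A. A $$ (i, i))"

definition density_mat :: "nat \<Rightarrow> complex mat \<Rightarrow> bool" where
  "density_mat N \<rho> \<longleftrightarrow> \<rho> \<in> carrier_mat N N \<and> psd \<rho> \<and> mat_trace \<rho> = 1"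

definition support :: "complex mat \<Rightarrow> complex vec set" where
  "support A = (\<lambda>v. A *\<^sub>v v) ` carrier_vec (dim_col A)"

definition matrix_unit :: "nat \<Rightarrow> nat \<Rightarrow> nat \<Rightarrow> complex mat" where
  "matrix_unit n i j = mat n n (\<lambda>(r, c). if r = i \<and> c = j then 1 else 0)"

(* Row and column indices of the Kronecker product encode the pair (i, k) as i * dim B + k;
   this identifies C^m (x) C^n with C^(m * n). *)
definition kron :: "complex mat \<Rightarrow> complex mat \<Rightarrow> complex mat" where
  "kron A B = mat (dim_row A * dim_row B) (dim_col A * dim_col B)
     (\<lambda>(r, c). A $$ (r div dim_row B, c div dim_col B) * B $$ (r mod dim_row B, c mod dim_col B))"

(* A linear map on M_n is a function on all complex matrices of which only the values on
   carrier_mat n n matter. *)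
abbreviation linear_on_mat :: "nat \<Rightarrow> (complex mat \<Rightarrow> complex mat) \<Rightarrow> bool" where
  "linear_on_mat n \<Phi> \<equiv>
     linear_map class_ring (module_mat TYPE(complex) n n) (module_mat TYPE(complex) n n) \<Phi>"

definition hermiticity_preserving :: "nat \<Rightarrow> (complex mat \<Rightarrow> complex mat) \<Rightarrow> bool" where
  "hermiticity_preserving n \<Phi> \<longleftrightarrow>
     (\<forall>A \<in> carrier_mat n n. hermitian_mat A \<longrightarrow> hermitian_mat (\<Phi> A))"

definition positive_map :: "nat \<Rightarrow> (complex mat \<Rightarrow> complex mat) \<Rightarrow> bool" where
  "positive_map n \<Phi> \<longleftrightarrow> (\<forall>A \<in> carrier_mat n n. psd A \<longrightarrow> psd (\<Phi> A))"

definition mat_block :: "nat \<Rightarrow> complex mat \<Rightarrow> nat \<Rightarrow> nat \<Rightarrow> complex mat" where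
  "mat_block n X i j = mat n n (\<lambda>(k, l). X $$ (i * n + k, j * n + l))"

(* The map I_m (x) \<Phi> applies \<Phi> to each of the m * m blocks of size n;
   see id_tensor_kron and id_tensor_linear. *)
definition id_tensor :: "nat \<Rightarrow> nat \<Rightarrow> (complex mat \<Rightarrow> complex mat) \<Rightarrow> complex mat \<Rightarrow> complex mat" where
  "id_tensor m n \<Phi> X = mat (m * n) (m * n)
     (\<lambda>(r, c). \<Phi> (mat_block n X (r div n) (c div n)) $$ (r mod n, c mod n))"

definition completely_positive :: "nat \<Rightarrow> (complex mat \<Rightarrow> complex mat) \<Rightarrow> bool" where
  "completely_positive n \<Phi> \<longleftrightarrow> (\<forall>m\<ge>1. positive_map (m * n) (id_tensor m n \<Phi>))"

definition choi :: "nat \<Rightarrow> (complex mat \<Rightarrow> complex mat) \<Rightarrow> complex mat" where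
  "choi n \<Phi> = finsum (module_mat TYPE(complex) (n * n) (n * n))
     (\<lambda>(i, j). kron (matrix_unit n i j) (\<Phi> (matrix_unit n i j))) ({..<n} \<times> {..<n})"

definition finer :: "nat \<Rightarrow> complex mat \<Rightarrow> complex mat \<Rightarrow> bool" where
  "finer n W\<^sub>1 W\<^sub>2 \<longleftrightarrow>
     (\<forall>\<rho>. density_mat (n * n) \<rho> \<and> mat_trace (W\<^sub>2 * \<rho>) < 0 \<longrightarrow> mat_trace (W\<^sub>1 * \<rho>) < 0)"

definition nu_admissible ::
    "nat \<Rightarrow> (complex mat \<Rightarrow> complex mat) \<Rightarrow> nat \<Rightarrow> complex vec set \<Rightarrow> bool" where
  "nu_admissible n \<Phi> m S \<longleftrightarrow>
     VectorSpace.subspace class_ring S (module_vec TYPE(complex) (m * n)) \<and>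
     (\<forall>\<rho>. density_mat (m * n) \<rho> \<and> support \<rho> \<subseteq> S \<longrightarrow> \<not> psd (id_tensor m n \<Phi> \<rho>))"

(* The set is nonempty and finite; see nu_set_finite and nu_set_nonempty. *)
definition nu_m :: "nat \<Rightarrow> (complex mat \<Rightarrow> complex mat) \<Rightarrow> nat \<Rightarrow> nat" where
  "nu_m n \<Phi> m = Max {vectorspace.dim class_ring (module_vec TYPE(complex) (m * n)\<lparr>carrier := S\<rparr>)
     | S. nu_admissible n \<Phi> m S}"

definition nu :: "nat \<Rightarrow> (complex mat \<Rightarrow> complex mat) \<Rightarrow> real" where
  "nu n \<Phi> = lim (\<lambda>m. real (nu_m n \<Phi> m) / real m)"

lemma div_mod_encode:
  fixes m n r :: nat
  assumes "r < m * n"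
  shows "r div n < m" "r mod n < n" "r div n * n + r mod n = r"
proof -
  have "0 < n" using assms by (cases n) auto
  then show "r mod n < n" by simp
qed (use assms in \<open>auto simp: less_mult_imp_div_less\<close>)

lemma encode_less:
  fixes m n i k :: nat
  assumes "i < m" "k < n"
  shows "i * n + k < m * n"
proof -
  have "i * n + k < Suc i * n" using assms by simp
  also have "\<dots> \<le> m * n" using assms by (intro mult_right_mono) auto
  finally show ?thesis .
qed

lemma linear_on_matD:
  assumes "linear_on_mat n \<Phi>"
  shows "A \<in> carrier_mat n n \<Longrightarrow> \<Phi> A \<in> carrier_mat n n"
    and "A \<in> carrier_mat n n \<Longrightarrow> B \<in> carrier_mat n n \<Longrightarrow> \<Phi> (A + B) = \<Phi> A + \<Phi> B"
    and "A \<in> carrier_mat n n \<Longrightarrow> \<Phi> (a \<cdot>\<^sub>m A) = a \<cdot>\<^sub>m \<Phi> A"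
proof -
  have h: "\<Phi> \<in> LinearCombinations.module_hom class_ring
      (module_mat TYPE(complex) n n) (module_mat TYPE(complex) n n)"
    using assms unfolding linear_map_def mod_hom_def mod_hom_axioms_def by blast
  show "A \<in> carrier_mat n n \<Longrightarrow> \<Phi> A \<in> carrier_mat n n"
    and "A \<in> carrier_mat n n \<Longrightarrow> B \<in> carrier_mat n n \<Longrightarrow> \<Phi> (A + B) = \<Phi> A + \<Phi> B"
    and "A \<in> carrier_mat n n \<Longrightarrow> \<Phi> (a \<cdot>\<^sub>m A) = a \<cdot>\<^sub>m \<Phi> A"
    using h unfolding LinearCombinations.module_hom_def
    by (auto simp: module_mat_simps class_ring_simps)
qed

lemma id_tensor_kron:
  assumes lin: "linear_on_mat n \<Phi>" and A: "A \<in> carrier_mat m m" and B: "B \<in> carrier_mat n n"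
  shows "id_tensor m n \<Phi> (kron A B) = kron A (\<Phi> B)"
proof -
  have \<Phi>B: "\<Phi> B \<in> carrier_mat n n" using linear_on_matD(1)[OF lin B] .
  have blk: "mat_block n (kron A B) i j = A $$ (i, j) \<cdot>\<^sub>m B" if "i < m" "j < m" for i j
    using that A B by (intro eq_matI) (auto simp: mat_block_def kron_def encode_less)
  show ?thesis
  proof (rule eq_matI)
    fix r c assume "r < dim_row (kron A (\<Phi> B))" "c < dim_col (kron A (\<Phi> B))"
    then have r: "r < m * n" and c: "c < m * n" using A \<Phi>B by (auto simp: kron_def)
    show "id_tensor m n \<Phi> (kron A B) $$ (r, c) = kron A (\<Phi> B) $$ (r, c)"
      using r c A B \<Phi>B div_mod_encode[OF r] div_mod_encode[OF c]
      by (simp add: id_tensor_def blk linear_on_matD(3)[OF lin B]) (simp add: kron_def)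
  qed (use A \<Phi>B in \<open>auto simp: id_tensor_def kron_def\<close>)
qed

lemma id_tensor_linear:
  assumes lin: "linear_on_mat n \<Phi>"
    and X: "X \<in> carrier_mat (m * n) (m * n)" and Y: "Y \<in> carrier_mat (m * n) (m * n)"
  shows "id_tensor m n \<Phi> (X + Y) = id_tensor m n \<Phi> X + id_tensor m n \<Phi> Y"
    and "id_tensor m n \<Phi> (a \<cdot>\<^sub>m X) = a \<cdot>\<^sub>m id_tensor m n \<Phi> X"
proof -
  have c: "mat_block n Z i j \<in> carrier_mat n n" for Z i j by (simp add: mat_block_def)
  have add: "mat_block n (X + Y) i j = mat_block n X i j + mat_block n Y i j"
    and smult: "mat_block n (a \<cdot>\<^sub>m X) i j = a \<cdot>\<^sub>m mat_block n X i j" if "i < m" "j < m" for i j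
    using that X Y by (auto intro!: eq_matI simp: mat_block_def encode_less)
  show "id_tensor m n \<Phi> (X + Y) = id_tensor m n \<Phi> X + id_tensor m n \<Phi> Y"
  proof (rule eq_matI)
    fix r s assume "r < dim_row (id_tensor m n \<Phi> X + id_tensor m n \<Phi> Y)"
      "s < dim_col (id_tensor m n \<Phi> X + id_tensor m n \<Phi> Y)"
    then have r: "r < m * n" and s: "s < m * n" by (auto simp: id_tensor_def)
    show "id_tensor m n \<Phi> (X + Y) $$ (r, s) = (id_tensor m n \<Phi> X + id_tensor m n \<Phi> Y) $$ (r, s)"
      using r s div_mod_encode[OF r] div_mod_encode[OF s]
        carrier_matD[OF linear_on_matD(1)[OF lin c]]
      by (simp add: id_tensor_def add linear_on_matD(2)[OF lin c c])
  qed (auto simp: id_tensor_def)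
  show "id_tensor m n \<Phi> (a \<cdot>\<^sub>m X) = a \<cdot>\<^sub>m id_tensor m n \<Phi> X"
  proof (rule eq_matI)
    fix r s assume "r < dim_row (a \<cdot>\<^sub>m id_tensor m n \<Phi> X)" "s < dim_col (a \<cdot>\<^sub>m id_tensor m n \<Phi> X)"
    then have r: "r < m * n" and s: "s < m * n" by (auto simp: id_tensor_def)
    show "id_tensor m n \<Phi> (a \<cdot>\<^sub>m X) $$ (r, s) = (a \<cdot>\<^sub>m id_tensor m n \<Phi> X) $$ (r, s)"
      using r s div_mod_encode[OF r] div_mod_encode[OF s]
        carrier_matD[OF linear_on_matD(1)[OF lin c]]
      by (simp add: id_tensor_def smult linear_on_matD(3)[OF lin c])
  qed (auto simp: id_tensor_def)
qed

lemma nu_set_finite: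
  "finite {vectorspace.dim class_ring (module_vec TYPE(complex) (m * n)\<lparr>carrier := S\<rparr>)
     | S. nu_admissible n \<Phi> m S}"
proof -
  interpret vec_space "TYPE(complex)" "m * n" .
  have "vectorspace.dim class_ring (module_vec TYPE(complex) (m * n)\<lparr>carrier := S\<rparr>) \<le> m * n"
    if "nu_admissible n \<Phi> m S" for S
  proof -
    have S: "VectorSpace.subspace class_ring S (module_vec TYPE(complex) (m * n))"
      using that by (simp add: nu_admissible_def)
    let ?V = "module_vec TYPE(complex) (m * n)"
    interpret S: vectorspace class_ring "?V\<lparr>carrier := S\<rparr>"
      using subspace_is_vs[OF S] .
    have sub: "submodule class_ring S ?V" using S by (simp add: subspace_def)
    have SV: "S \<subseteq> carrier ?V" using sub by (simp add: submodule_def)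
    have bound: "finite A \<and> card A \<le> m * n" if "A \<subseteq> S \<and> S.lin_indpt A" for A
    proof -
      have "lin_indpt A" using span_li_not_depend(2)[OF _ sub] that by blast
      then show ?thesis using li_le_dim[OF fin_dim, of A] that SV dim_is_n by auto
    qed
    have "S.lin_indpt {}" by (simp add: S.lin_dep_def)
    then obtain A where A: "finite A" "maximal A (\<lambda>A. A \<subseteq> S \<and> S.lin_indpt A)"
      using maximal_exists[of "\<lambda>A. A \<subseteq> S \<and> S.lin_indpt A" "m * n" "{}"] bound by blast
    then have "S.gen_set A" using S.max_li_is_gen[of A] by simp
    moreover have "A \<subseteq> S" using A by (simp add: maximal_def)
    ultimately have "S.dim \<le> card A" using A(1) S.gen_ge_dim by simp
    also have "\<dots> \<le> m * n" using A bound by (simp add: maximal_def)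
    finally show ?thesis .
  qed
  then have "{vectorspace.dim class_ring (module_vec TYPE(complex) (m * n)\<lparr>carrier := S\<rparr>)
     | S. nu_admissible n \<Phi> m S} \<subseteq> {..m * n}" by auto
  then show ?thesis by (rule finite_subset) simp
qed

lemma nu_set_nonempty: "\<exists>S. nu_admissible n \<Phi> m S"
proof -
  let ?N = "m * n"
  interpret vec_space "TYPE(complex)" ?N .
  have "VectorSpace.subspace class_ring {0\<^sub>v ?N} (module_vec TYPE(complex) ?N)"
    using span_is_subspace[of "{}"] by (simp add: span_empty module_vec_simps)
  moreover have "\<not> (density_mat ?N \<rho> \<and> support \<rho> \<subseteq> {0\<^sub>v ?N})" for \<rho>
  proof
    assume a: "density_mat ?N \<rho> \<and> support \<rho> \<subseteq> {0\<^sub>v ?N}"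
    then have \<rho>: "\<rho> \<in> carrier_mat ?N ?N" by (simp add: density_mat_def)
    have "\<rho> $$ (i, i) = 0" if i: "i < ?N" for i
    proof -
      have "\<rho> *\<^sub>v unit_vec ?N i \<in> support \<rho>" using \<rho> by (auto simp: support_def)
      then have "\<rho> *\<^sub>v unit_vec ?N i = 0\<^sub>v ?N" using a by auto
      then have "(\<rho> *\<^sub>v unit_vec ?N i) $ i = 0" using i by simp
      then show ?thesis using \<rho> i by simp
    qed
    then have "mat_trace \<rho> = 0" using \<rho> by (auto simp: mat_trace_def)
    then show False using a by (simp add: density_mat_def)
  qed
  ultimately show ?thesis unfolding nu_admissible_def by blast
qed

end

theory Submission
  imports Defs "Jordan_Normal_Form.DL_Rank"
begin

text \<open>For a vector \<open>v\<close> in the \<open>m n\<close>-dimensional space, the number \<open>\<langle>v, (I\<^sub>m \<otimes> \<Phi>)(X) v\<rangle>\<close> equals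
  \<open>Tr (J(\<Phi>) \<tau>)\<close>, where \<open>\<tau>\<close> is obtained by contracting \<open>X\<close> with \<open>v\<close>, does not depend on \<open>\<Phi>\<close>, and is
  positive semidefinite when \<open>X\<close> is. So if \<open>(I\<^sub>m \<otimes> \<Phi>\<^sub>2)(X)\<close> has a negative direction, then so does
  \<open>(I\<^sub>m \<otimes> \<Phi>\<^sub>1)(X)\<close>; every subspace admissible for \<open>\<Phi>\<^sub>2\<close> is admissible for \<open>\<Phi>\<^sub>1\<close>, and
  \<open>\<nu>\<^sub>m(\<Phi>\<^sub>2) \<le> \<nu>\<^sub>m(\<Phi>\<^sub>1)\<close> for every \<open>m\<close>. The limits defining \<open>\<nu>\<close> exist by Fekete's lemma: direct sums of
  admissible subspaces are admissible, as one sees on principal blocks, so \<open>m \<mapsto> \<nu>\<^sub>m(\<Phi>)\<close> is superadditive.\<close>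

subsection \<open>Superadditive sequences and direct sums of subspaces\<close>

text \<open>Fekete's lemma. The limit is the supremum \<open>L\<close> of the quotients. If the
  quotient at \<open>M\<close> is close to \<open>L\<close> and \<open>m = q * M + r\<close> with
  \<open>r < M\<close>, superadditivity gives \<open>a m \<ge> q * a M\<close>, and
  \<open>q \<ge> m / M - 1\<close>, so the quotient at \<open>m\<close> falls short of the one at
  \<open>M\<close> by at most \<open>a M / m\<close>.\<close>

lemma superadditive_convergent:
  fixes a :: "nat \<Rightarrow> nat"
  assumes super: "\<And>m k. a m + a k \<le> a (m + k)" and bound: "\<And>m. a m \<le> C * m"
  shows "convergent (\<lambda>m. real (a m) / real m)"
proof -
  define b where "b m = real (a m) / real m" for m
  \<comment> \<open>Index 0 is left out because \<open>b 0\<close> is a division by zero.\<close>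
  define L where "L = Sup (b ` {1..})"
  have b_le: "b m \<le> real C" for m
    using bound[of m] by (cases "m = 0") (simp_all add: b_def divide_le_eq mult.commute flip: of_nat_mult)
  then have bdd: "bdd_above (b ` {1..})" by (intro bdd_aboveI[of _ "real C"]) auto
  have le_L: "b m \<le> L" if "m \<ge> 1" for m
    unfolding L_def using bdd that by (intro cSup_upper) auto
  have mult: "q * a M \<le> a (q * M)" for q M
  proof (induction q)
    case (Suc q)
    then show ?case using super[of M "q * M"] by simp
  qed simp
  have "b \<longlonglongrightarrow> L"
  proof (rule LIMSEQ_I)
    fix e :: real assume e: "0 < e"
    then obtain M where M: "M \<ge> 1" "L - e / 2 < b M"
      using less_cSup_iff[OF _ bdd, of "L - e / 2"] L_def by auto
    \<comment> \<open>Half of \<open>e\<close> is spent on choosing \<open>M\<close>; this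
      \<open>N\<close> makes the loss \<open>a M / m\<close> smaller than the other half. Below,
      \<open>max N 1\<close> also keeps \<open>m\<close> positive.\<close>
    obtain N :: nat where N: "real (a M) / (e / 2) < real N" using reals_Archimedean2 by blast
    have "norm (b m - L) < e" if m: "m \<ge> max N 1" for m
    proof -
      define q where "q = m div M"
      have "m mod M < M" using M by simp
      then have "m < (q + 1) * M" using div_mult_mod_eq[of m M] by (simp add: q_def, linarith)
      then have "real m < real ((q + 1) * M)" by (simp only: of_nat_less_iff)
      then have "real m < (real q + 1) * real M" by (simp add: algebra_simps)
      then have "real m / real M - 1 \<le> real q" using M by (simp add: field_simps)
      then have "(real m / real M - 1) * real (a M) \<le> real q * real (a M)"
        by (intro mult_right_mono) auto
      also have "\<dots> \<le> real (a (q * M))" using mult[of q M] by (simp flip: of_nat_mult)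
      also have "\<dots> \<le> real (a m)"
        using super[of "q * M" "m mod M"] by (simp add: q_def)
      finally have "(real m / real M - 1) * real (a M) / real m \<le> b m"
        unfolding b_def by (rule divide_right_mono) simp
      moreover have "(real m / real M - 1) * real (a M) / real m = b M - real (a M) / real m"
        using m M by (simp add: b_def field_simps)
      moreover have "real (a M) / real m < e / 2"
      proof -
        have "real (a M) / (e / 2) < real m" using N m by linarith
        then show ?thesis using e m by (simp add: field_simps)
      qed
      ultimately have "L - e < b m" using M by linarith
      then show ?thesis using le_L[of m] m e by (simp add: abs_if)
    qed
    then show "\<exists>no. \<forall>m\<ge>no. norm (b m - L) < e" by blast
  qed
  then show ?thesis unfolding b_def by (auto simp: convergent_def)
qed

section \<open>Subspaces of coordinate spaces and their direct sums\<close>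

lemma subspace_vec_iff:
  "VectorSpace.subspace class_ring S (module_vec TYPE('a::field) N) \<longleftrightarrow>
     S \<subseteq> carrier_vec N \<and> 0\<^sub>v N \<in> S \<and> (\<forall>u\<in>S. \<forall>v\<in>S. u + v \<in> S) \<and> (\<forall>c. \<forall>u\<in>S. c \<cdot>\<^sub>v u \<in> S)"
  using vec_vs[of N, where 'a='a] vec_module[of N, where 'a='a]
  by (auto simp: VectorSpace.subspace_def LinearCombinations.submodule_def module_vec_simps class_ring_simps)

text \<open>An independent subset of \<open>S\<close> stays independent in the ambient space and so
  has at most \<open>N\<close> elements. Hence a maximal one exists, starting from the empty set,
  and it is a finite generating set of \<open>S\<close>.\<close>

lemma subspace_fin_dim:
  assumes S: "VectorSpace.subspace class_ring S (module_vec TYPE('a::field) N)"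
  shows "vectorspace.fin_dim class_ring (module_vec TYPE('a) N\<lparr>carrier := S\<rparr>)"
    and "vectorspace.dim class_ring (module_vec TYPE('a) N\<lparr>carrier := S\<rparr>) \<le> N"
proof -
  interpret vec_space "TYPE('a)" N .
  interpret S: vectorspace class_ring "V\<lparr>carrier := S\<rparr>" using subspace_is_vs[OF S] .
  have sub: "submodule class_ring S V" using S by (simp add: subspace_def)
  have SV: "S \<subseteq> carrier V" using sub by (simp add: submodule_def)
  have bound: "finite A \<and> card A \<le> N" if "A \<subseteq> S \<and> S.lin_indpt A" for A
  proof -
    have "lin_indpt A" using span_li_not_depend(2)[OF _ sub] that by blast
    then show ?thesis using li_le_dim[OF fin_dim, of A] that SV dim_is_n by auto
  qed
  have "S.lin_indpt {}" by (simp add: S.lin_dep_def)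
  then obtain A where A: "finite A" "maximal A (\<lambda>A. A \<subseteq> S \<and> S.lin_indpt A)"
    using maximal_exists[of "\<lambda>A. A \<subseteq> S \<and> S.lin_indpt A" N "{}"] bound by blast
  then have "S.gen_set A" using S.max_li_is_gen[of A] by simp
  moreover have "A \<subseteq> S" using A by (simp add: maximal_def)
  ultimately show *: "S.fin_dim" unfolding S.fin_dim_def using A(1) by auto
  show "S.dim \<le> N" using subspace_dim[OF S fin_dim *] dim_is_n by simp
qed

text \<open>The external direct sum of \<open>S\<close> and \<open>T\<close>, placed inside the
  space of dimension \<open>M + N\<close>. Membership is tested on the two coordinate projections
  rather than by concatenation, so closure conditions can be checked separately on each
  part.\<close>

definition block_subspace :: "nat \<Rightarrow> nat \<Rightarrow> 'a vec set \<Rightarrow> 'a vec set \<Rightarrow> 'a vec set" where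
  "block_subspace M N S T = {u \<in> carrier_vec (M + N). vec_first u M \<in> S \<and> vec_last u N \<in> T}"

lemma vec_first_last_append_vec:
  assumes "v \<in> carrier_vec M" "w \<in> carrier_vec N"
  shows "vec_first (v @\<^sub>v w) M = v" "vec_last (v @\<^sub>v w) N = w"
  using assms by (auto simp: vec_first_def vec_last_def)

lemma block_subspace_iff:
  assumes "S \<subseteq> carrier_vec M" "T \<subseteq> carrier_vec N"
  shows "u \<in> block_subspace M N S T \<longleftrightarrow> (\<exists>v\<in>S. \<exists>w\<in>T. u = v @\<^sub>v w)"
proof
  assume "u \<in> block_subspace M N S T"
  then show "\<exists>v\<in>S. \<exists>w\<in>T. u = v @\<^sub>v w"
    unfolding block_subspace_def by (metis (mono_tags, lifting) mem_Collect_eq vec_first_last_append)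
next
  assume "\<exists>v\<in>S. \<exists>w\<in>T. u = v @\<^sub>v w"
  then obtain v w where u: "v \<in> S" "w \<in> T" "u = v @\<^sub>v w" by blast
  moreover have "v \<in> carrier_vec M" "w \<in> carrier_vec N" using u assms by auto
  ultimately show "u \<in> block_subspace M N S T"
    by (simp add: block_subspace_def vec_first_last_append_vec)
qed

lemma linear_map_vecI:
  assumes S: "VectorSpace.subspace class_ring S (module_vec TYPE('a::field) M)"
    and T: "VectorSpace.subspace class_ring T (module_vec TYPE('a) N)"
    and "\<And>u. u \<in> S \<Longrightarrow> f u \<in> T"
    and "\<And>u v. u \<in> S \<Longrightarrow> v \<in> S \<Longrightarrow> f (u + v) = f u + f v"
    and "\<And>c u. u \<in> S \<Longrightarrow> f (c \<cdot>\<^sub>v u) = c \<cdot>\<^sub>v f u"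
  shows "linear_map class_ring (module_vec TYPE('a) M\<lparr>carrier := S\<rparr>)
     (module_vec TYPE('a) N\<lparr>carrier := T\<rparr>) f"
proof -
  interpret V: vec_space "TYPE('a)" M .
  interpret W: vec_space "TYPE('a)" N .
  interpret S: vectorspace class_ring "V.V\<lparr>carrier := S\<rparr>" using V.subspace_is_vs[OF S] .
  interpret T: vectorspace class_ring "W.V\<lparr>carrier := T\<rparr>" using W.subspace_is_vs[OF T] .
  have "f \<in> LinearCombinations.module_hom class_ring (V.V\<lparr>carrier := S\<rparr>) (W.V\<lparr>carrier := T\<rparr>)"
    unfolding LinearCombinations.module_hom_def
    using assms(3-) by (simp add: module_vec_simps class_ring_simps Pi_def)
  then show ?thesis
    by (intro linear_map.intro mod_hom.intro mod_hom_axioms.intro S.module_axioms T.module_axioms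
        S.vectorspace_axioms T.vectorspace_axioms)
qed

lemma vec_first_last_linear:
  assumes "u \<in> carrier_vec (M + N)" "v \<in> carrier_vec (M + N)"
  shows "vec_first (u + v) M = vec_first u M + vec_first v M"
    and "vec_last (u + v) N = vec_last u N + vec_last v N"
    and "vec_first (c \<cdot>\<^sub>v u) M = c \<cdot>\<^sub>v vec_first u M"
    and "vec_last (c \<cdot>\<^sub>v u) N = c \<cdot>\<^sub>v vec_last u N"
  using assms by (auto simp: vec_first_def vec_last_def)

lemma vec_first_last_zero: "vec_first (0\<^sub>v (M + N)) M = 0\<^sub>v M" "vec_last (0\<^sub>v (M + N)) N = 0\<^sub>v N"
  by (auto simp: vec_first_def vec_last_def)

text \<open>The dimension comes from rank-nullity for the projection to the first \<open>M\<close>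
  coordinates: its image is \<open>S\<close>, and its kernel is a copy of \<open>T\<close> padded
  with zeros.\<close>

lemma
  assumes S: "VectorSpace.subspace class_ring S (module_vec TYPE('a::field) M)"
    and T: "VectorSpace.subspace class_ring T (module_vec TYPE('a) N)"
  shows block_subspace_subspace:
      "VectorSpace.subspace class_ring (block_subspace M N S T) (module_vec TYPE('a) (M + N))"
    and block_subspace_dim:
      "vectorspace.dim class_ring (module_vec TYPE('a) (M + N)\<lparr>carrier := block_subspace M N S T\<rparr>) =
       vectorspace.dim class_ring (module_vec TYPE('a) M\<lparr>carrier := S\<rparr>) +
       vectorspace.dim class_ring (module_vec TYPE('a) N\<lparr>carrier := T\<rparr>)"
proof -
  let ?D = "block_subspace M N S T"
  note S' = S[unfolded subspace_vec_iff] and T' = T[unfolded subspace_vec_iff]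
  \<comment> \<open>Stated for arbitrary \<open>S\<close> and \<open>T\<close>, since it is applied
    once to the given pair and once to the kernel, where the first summand is the zero
    space.\<close>
  have sub: "VectorSpace.subspace class_ring (block_subspace M N S T) (module_vec TYPE('a) (M + N))"
    if "VectorSpace.subspace class_ring S (module_vec TYPE('a) M)"
      "VectorSpace.subspace class_ring T (module_vec TYPE('a) N)" for S T
    using that unfolding subspace_vec_iff
    by (auto simp: block_subspace_def vec_first_last_linear vec_first_last_zero)
  show D: "VectorSpace.subspace class_ring ?D (module_vec TYPE('a) (M + N))" by (rule sub[OF S T])
  let ?K = "block_subspace M N {0\<^sub>v M} T"
  have Z: "VectorSpace.subspace class_ring {0\<^sub>v M} (module_vec TYPE('a) M)"
    unfolding subspace_vec_iff by auto
  have K_iff: "u \<in> ?K \<longleftrightarrow> (\<exists>w\<in>T. u = 0\<^sub>v M @\<^sub>v w)" for u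
    using block_subspace_iff[of "{0\<^sub>v M}" M T N] T' by simp
  have D_iff: "u \<in> ?D \<longleftrightarrow> (\<exists>v\<in>S. \<exists>w\<in>T. u = v @\<^sub>v w)" for u
    using block_subspace_iff[of S M T N] S' T' by simp
  note K = sub[OF Z T]
  have F: "linear_map class_ring (module_vec TYPE('a) (M + N)\<lparr>carrier := ?D\<rparr>)
     (module_vec TYPE('a) M\<lparr>carrier := S\<rparr>) (\<lambda>u. vec_first u M)"
    by (rule linear_map_vecI[OF D S]) (auto simp: block_subspace_def vec_first_last_linear)
  then interpret F: linear_map class_ring "module_vec TYPE('a) (M + N)\<lparr>carrier := ?D\<rparr>"
     "module_vec TYPE('a) M\<lparr>carrier := S\<rparr>" "\<lambda>u. vec_first u M" .
  \<comment> \<open>Padding with zeros is an isomorphism from \<open>T\<close> onto the kernel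
    \<open>?K\<close>.\<close>
  have G: "linear_map class_ring (module_vec TYPE('a) N\<lparr>carrier := T\<rparr>)
     (module_vec TYPE('a) (M + N)\<lparr>carrier := ?K\<rparr>) (\<lambda>u. 0\<^sub>v M @\<^sub>v u)"
  proof (rule linear_map_vecI[OF T K])
    fix u v c assume "u \<in> T" "v \<in> T"
    then have uv: "u \<in> carrier_vec N" "v \<in> carrier_vec N" using T' by auto
    show "0\<^sub>v M @\<^sub>v (u + v) = (0\<^sub>v M @\<^sub>v u) + (0\<^sub>v M @\<^sub>v v)"
      by (rule eq_vecI) (use uv in \<open>auto simp: append_vec_def\<close>)
  next
    fix u c assume "u \<in> T"
    then have uv: "u \<in> carrier_vec N" using T' by auto
    show "0\<^sub>v M @\<^sub>v (c \<cdot>\<^sub>v u) = c \<cdot>\<^sub>v (0\<^sub>v M @\<^sub>v u)"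
      by (rule eq_vecI) (use uv in \<open>auto simp: append_vec_def\<close>)
    show "0\<^sub>v M @\<^sub>v u \<in> ?K"
      using \<open>u \<in> T\<close> K_iff by blast
  qed
  have "vectorspace.dim class_ring (module_vec TYPE('a) N\<lparr>carrier := T\<rparr>) =
    vectorspace.dim class_ring (module_vec TYPE('a) (M + N)\<lparr>carrier := ?K\<rparr>)"
  proof (rule linear_map.dim_eq[OF G])
    show "vectorspace.fin_dim class_ring (module_vec TYPE('a) N\<lparr>carrier := T\<rparr>)"
      by (rule subspace_fin_dim(1)[OF T])
    show "inj_on (\<lambda>u. 0\<^sub>v M @\<^sub>v u) (carrier (module_vec TYPE('a) N\<lparr>carrier := T\<rparr>))"
      by (rule inj_onI) (simp add: append_vec_eq[OF zero_carrier_vec zero_carrier_vec])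
    show "(@\<^sub>v) (0\<^sub>v M) ` carrier (module_vec TYPE('a) N\<lparr>carrier := T\<rparr>)
       = carrier (module_vec TYPE('a) (M + N)\<lparr>carrier := ?K\<rparr>)"
      by (auto simp: K_iff)
  qed
  moreover have "F.kerT = ?K"
    unfolding F.ker_def using S' by (auto simp: block_subspace_def module_vec_simps)
  moreover have "F.imT = S"
  proof -
    have "v \<in> (\<lambda>u. vec_first u M) ` ?D" if "v \<in> S" for v
    proof
      have "v \<in> carrier_vec M" using that S' by blast
      then show "v = vec_first (v @\<^sub>v 0\<^sub>v N) M"
        by (simp add: vec_first_last_append_vec(1)[of _ M _ N])
      show "v @\<^sub>v 0\<^sub>v N \<in> ?D" unfolding D_iff using that T' by blast
    qed
    then show ?thesis unfolding F.im_def by (auto simp: block_subspace_def)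
  qed
  ultimately show "vectorspace.dim class_ring (module_vec TYPE('a) (M + N)\<lparr>carrier := ?D\<rparr>) =
       vectorspace.dim class_ring (module_vec TYPE('a) M\<lparr>carrier := S\<rparr>) +
       vectorspace.dim class_ring (module_vec TYPE('a) N\<lparr>carrier := T\<rparr>)"
    using F.rank_nullity[OF subspace_fin_dim(1)[OF D]] by simp
qed

subsection \<open>Quadratic forms of Hermitian matrices\<close>

text \<open>The vector is a function on indices, of which only the values below \<open>N\<close>
  matter. Shifts, reindexings and contractions of vectors then need no carrier conditions.\<close>

definition qform :: "nat \<Rightarrow> complex mat \<Rightarrow> (nat \<Rightarrow> complex) \<Rightarrow> complex" where
  "qform N A f = (\<Sum>r<N. \<Sum>c<N. A $$ (r, c) * f c * cnj (f r))"

lemma qform_alt: "qform N A f = (\<Sum>r<N. (\<Sum>c<N. A $$ (r, c) * f c) * cnj (f r))"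
  by (simp add: qform_def sum_distrib_right)

lemma hermitian_mat_iff:
  assumes "A \<in> carrier_mat N N"
  shows "hermitian_mat A \<longleftrightarrow> (\<forall>r<N. \<forall>c<N. A $$ (r, c) = cnj (A $$ (c, r)))"
proof -
  have adj: "mat_adjoint A \<in> carrier_mat N N"
    "\<And>r c. r < N \<Longrightarrow> c < N \<Longrightarrow> mat_adjoint A $$ (r, c) = cnj (A $$ (c, r))"
    using assms by (auto simp: mat_adjoint_def mat_of_rows_index)
  have "hermitian_mat A \<longleftrightarrow> A = mat_adjoint A"
    using assms by (auto simp: hermitian_mat_def)
  also have "\<dots> \<longleftrightarrow> (\<forall>r<N. \<forall>c<N. A $$ (r, c) = mat_adjoint A $$ (r, c))"
    using adj(1) assms by (auto simp: mat_eq_iff)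
  also have "\<dots> \<longleftrightarrow> (\<forall>r<N. \<forall>c<N. A $$ (r, c) = cnj (A $$ (c, r)))"
    by (simp add: adj(2))
  finally show ?thesis .
qed

lemma qform_vec:
  assumes "A \<in> carrier_mat N N" "v \<in> carrier_vec N"
  shows "(A *\<^sub>v v) \<bullet>c v = qform N A (\<lambda>i. v $ i)"
  using assms by (simp add: qform_def scalar_prod_def lessThan_atLeast0 sum_distrib_right)

lemma qform_cong: "(\<And>i. i < N \<Longrightarrow> f i = g i) \<Longrightarrow> qform N A f = qform N A g"
  unfolding qform_def by (intro sum.cong refl) auto

text \<open>Quantifying over functions instead of vectors changes nothing, because the form reads
  \<open>f\<close> only below \<open>N\<close>.\<close>

lemma psd_iff:
  assumes A: "A \<in> carrier_mat N N"
  shows "psd A \<longleftrightarrow> (\<forall>r<N. \<forall>c<N. A $$ (r, c) = cnj (A $$ (c, r))) \<and> (\<forall>f. 0 \<le> qform N A f)"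
proof -
  have "(\<forall>v\<in>carrier_vec N. 0 \<le> (A *\<^sub>v v) \<bullet>c v) \<longleftrightarrow> (\<forall>f. 0 \<le> qform N A f)"
  proof
    assume a: "\<forall>v\<in>carrier_vec N. 0 \<le> (A *\<^sub>v v) \<bullet>c v"
    show "\<forall>f. 0 \<le> qform N A f"
    proof
      fix f
      have "0 \<le> (A *\<^sub>v vec N f) \<bullet>c vec N f" using a by simp
      also have "\<dots> = qform N A f"
        unfolding qform_vec[OF A vec_carrier] by (rule qform_cong) simp
      finally show "0 \<le> qform N A f" .
    qed
  qed (use A in \<open>auto simp: qform_vec[OF A]\<close>)
  then show ?thesis using A by (simp add: psd_def hermitian_mat_iff[OF A])
qed

lemma psd_hermitian:
  "A \<in> carrier_mat N N \<Longrightarrow> psd A \<Longrightarrow> r < N \<Longrightarrow> c < N \<Longrightarrow> A $$ (r, c) = cnj (A $$ (c, r))"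
  using psd_iff by blast

lemma psd_qform_nonneg: "A \<in> carrier_mat N N \<Longrightarrow> psd A \<Longrightarrow> 0 \<le> qform N A f"
  using psd_iff by blast

text \<open>Conjugation exchanges the two summation indices, and Hermitian symmetry undoes the
  exchange.\<close>

lemma qform_real:
  assumes "\<And>r c. r < N \<Longrightarrow> c < N \<Longrightarrow> A $$ (r, c) = cnj (A $$ (c, r))"
  shows "Im (qform N A f) = 0"
proof -
  have "cnj (qform N A f) = (\<Sum>r<N. \<Sum>c<N. cnj (A $$ (r, c)) * cnj (f c) * f r)"
    by (simp add: qform_def)
  also have "\<dots> = (\<Sum>r<N. \<Sum>c<N. A $$ (c, r) * cnj (f c) * f r)"
    using assms by (intro sum.cong refl) (metis lessThan_iff)
  also have "\<dots> = qform N A f"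
    unfolding qform_def by (subst sum.swap) (simp add: mult_ac)
  finally show ?thesis by (simp add: complex_eq_iff)
qed

lemma psd_diag_nonneg:
  assumes A: "A \<in> carrier_mat N N" and "psd A" and i: "i < N"
  shows "0 \<le> A $$ (i, i)"
proof -
  have "qform N A (\<lambda>j. if j = i then 1 else 0) = A $$ (i, i)"
  proof -
    have "(\<Sum>c<N. A $$ (r, c) * (if c = i then 1 else 0)) = A $$ (r, i)" for r
      using i by (simp add: if_distrib[of "(*) _"] cong: if_cong)
    then show ?thesis
      using i by (simp add: qform_alt if_distrib[of cnj] if_distrib[of "(*) _"] cong: if_cong)
  qed
  then show ?thesis using psd_qform_nonneg[OF assms(1,2)] by metis
qed

lemma psd_trace_nonneg:
  assumes "A \<in> carrier_mat N N" and "psd A"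
  shows "0 \<le> mat_trace A"
  using assms psd_diag_nonneg by (auto simp: mat_trace_def intro!: sum_nonneg)

text \<open>Nonnegative diagonal entries with sum zero all vanish. A nonzero off-diagonal entry
  would then make the form negative at a suitable vector.\<close>

lemma psd_trace_zero:
  assumes A: "A \<in> carrier_mat N N" and psd: "psd A" and tr: "mat_trace A = 0"
  shows "A = 0\<^sub>m N N"
proof (rule eq_matI)
  have "(\<Sum>i<N. A $$ (i, i)) = 0" using tr A by (simp add: mat_trace_def)
  then have "\<forall>i\<in>{..<N}. A $$ (i, i) = 0"
    using psd_diag_nonneg[OF A psd] by (subst (asm) sum_nonneg_eq_0_iff) auto
  then have diag: "A $$ (i, i) = 0" if "i < N" for i using that by simp
  fix i j assume "i < dim_row (0\<^sub>m N N :: complex mat)" "j < dim_col (0\<^sub>m N N :: complex mat)"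
  then have ij: "i < N" "j < N" by auto
  have "A $$ (i, j) = 0" if "i \<noteq> j"
  proof -
    \<comment> \<open>The test vector has entry \<open>p\<close> at \<open>i\<close> and 1 at
      \<open>j\<close>. With zero diagonal the form is \<open>A $$ (i, j) * cnj p\<close> plus its
      conjugate, so this \<open>p\<close> makes it minus twice the squared modulus of the
      entry.\<close>
    define p where "p = - A $$ (i, j)"
    define f where "f k = (if k = i then p else 0) + (if k = j then 1 else 0)" for k
    have *: "(\<Sum>c<N. B c * f c) = B i * p + B j" for B
      using ij by (simp add: f_def distrib_left sum.distrib if_distrib[of "(*) _"] cong: if_cong)
    have **: "(\<Sum>r<N. B r * cnj (f r)) = B i * cnj p + B j" for B
      using ij by (simp add: f_def distrib_left sum.distrib if_distrib[of "(*) _"] if_distrib[of cnj]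
          cong: if_cong)
    have "qform N A f = (A $$ (i, i) * p + A $$ (i, j)) * cnj p + (A $$ (j, i) * p + A $$ (j, j))"
      unfolding qform_alt by (simp only: * **)
    also have "A $$ (j, i) = cnj (A $$ (i, j))" by (rule psd_hermitian[OF A psd ij(2,1)])
    finally have "qform N A f = - 2 * (A $$ (i, j) * cnj (A $$ (i, j)))"
      using diag ij by (simp add: p_def)
    also have "\<dots> = complex_of_real (- 2 * (cmod (A $$ (i, j)))\<^sup>2)"
      by (simp only: complex_norm_square of_real_mult) simp
    finally have eq: "qform N A f = complex_of_real (- 2 * (cmod (A $$ (i, j)))\<^sup>2)" .
    have "0 \<le> qform N A f" by (rule psd_qform_nonneg[OF A psd])
    then have "0 \<le> - 2 * (cmod (A $$ (i, j)))\<^sup>2"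
      unfolding eq less_eq_complex_def by (simp only: Re_complex_of_real zero_complex.sel)
    then show ?thesis by simp
  qed
  then show "A $$ (i, j) = 0\<^sub>m N N $$ (i, j)" using diag ij by (cases "i = j") auto
qed (use A in auto)

lemma qform_smult: "A \<in> carrier_mat N N \<Longrightarrow> qform N (a \<cdot>\<^sub>m A) f = a * qform N A f"
  by (simp add: qform_def sum_distrib_left mult_ac)

lemma psd_smult:
  assumes A: "A \<in> carrier_mat N N" and "psd A" and "0 \<le> t"
  shows "psd (complex_of_real t \<cdot>\<^sub>m A)"
proof -
  let ?B = "complex_of_real t \<cdot>\<^sub>m A"
  have "?B $$ (r, c) = cnj (?B $$ (c, r))" if "r < N" "c < N" for r c
  proof -
    have "A $$ (r, c) = cnj (A $$ (c, r))" by (rule psd_hermitian[OF assms(1,2) that])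
    then show ?thesis using that A by simp
  qed
  moreover have "0 \<le> qform N ?B f" for f
  proof -
    have "0 \<le> qform N A f" by (rule psd_qform_nonneg[OF assms(1,2)])
    then show ?thesis
      using assms(3) by (simp add: qform_smult[OF A] less_eq_complex_def)
  qed
  ultimately show ?thesis using psd_iff[of ?B N] A by simp
qed

section \<open>Scaling to density matrices\<close>

lemma mat_trace_smult: "mat_trace (a \<cdot>\<^sub>m A) = a * mat_trace A" if "A \<in> carrier_mat N N"
  using that by (simp add: mat_trace_def sum_distrib_left)

lemma density_normalise:
  assumes A: "A \<in> carrier_mat N N" and psd: "psd A" and "mat_trace A \<noteq> 0"
  obtains t where "0 < t" "density_mat N (complex_of_real t \<cdot>\<^sub>m A)"
proof -
  define s where "s = Re (mat_trace A)"
  have tr: "mat_trace A = of_real s" and s: "0 < s"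
    using psd_trace_nonneg[OF A psd] assms(3)
    by (auto simp: s_def less_eq_complex_def complex_eq_iff)
  show thesis
  proof
    show "0 < 1 / s" using s by simp
    show "density_mat N (complex_of_real (1 / s) \<cdot>\<^sub>m A)"
      using A s psd_smult[OF A psd, of "1 / s"]
      by (simp add: density_mat_def mat_trace_smult[OF A] tr)
  qed
qed

text \<open>\<open>finer\<close> speaks of density matrices only. A positive semidefinite
  \<open>\<tau>\<close> with a negative trace against \<open>W\<^sub>2\<close> is nonzero, hence has
  positive trace, and rescaling it by a positive number does not change the signs of either
  trace.\<close>

lemma finer_psd:
  assumes fin: "finer n W\<^sub>1 W\<^sub>2"
    and W: "W\<^sub>1 \<in> carrier_mat (n * n) (n * n)" "W\<^sub>2 \<in> carrier_mat (n * n) (n * n)"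
    and \<tau>: "\<tau> \<in> carrier_mat (n * n) (n * n)" "psd \<tau>" and neg: "mat_trace (W\<^sub>2 * \<tau>) < 0"
  shows "mat_trace (W\<^sub>1 * \<tau>) < 0"
proof -
  have "mat_trace \<tau> \<noteq> 0"
  proof
    assume "mat_trace \<tau> = 0"
    then have "\<tau> = 0\<^sub>m (n * n) (n * n)" using psd_trace_zero[OF \<tau>] by simp
    then have "mat_trace (W\<^sub>2 * \<tau>) = 0" using W by (simp add: mat_trace_def)
    then show False using neg by simp
  qed
  then obtain t where t: "0 < t" "density_mat (n * n) (complex_of_real t \<cdot>\<^sub>m \<tau>)"
    using density_normalise[OF \<tau>] by blast
  have eq: "mat_trace (W * (complex_of_real t \<cdot>\<^sub>m \<tau>)) = complex_of_real t * mat_trace (W * \<tau>)"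
    if "W \<in> carrier_mat (n * n) (n * n)" for W
    using that \<tau> by (simp add: mult_smult_distrib[of W "n * n" "n * n" \<tau> "n * n"] mat_trace_smult[of _ "n * n"])
  have scale: "complex_of_real t * z < 0 \<longleftrightarrow> z < 0" for z
    using t(1) by (auto simp: less_complex_def mult_less_0_iff)
  show ?thesis using fin t neg unfolding finer_def by (metis eq scale W)
qed

lemma sum_encode:
  fixes F :: "nat \<Rightarrow> 'a::comm_monoid_add"
  shows "(\<Sum>r<m * n. F r) = (\<Sum>i<m. \<Sum>k<n. F (i * n + k))"
proof -
  have "(\<Sum>r<m * n. F r) = (\<Sum>i<m. sum F {i * n..<i * n + n})"
    by (rule sum.nat_group[symmetric])
  also have "\<dots> = (\<Sum>i<m. \<Sum>k<n. F (i * n + k))"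
    by (subst sum.atLeastLessThan_shift_0) (simp add: lessThan_atLeast0)
  finally show ?thesis .
qed

subsection \<open>The quadratic form of the ampliation\<close>

text \<open>Turns the module sum that defines \<open>choi\<close> into ordinary sums of
  entries.\<close>

lemma finsum_module_mat:
  assumes "finite I" and "\<And>x. x \<in> I \<Longrightarrow> f x \<in> carrier_mat nr nc"
  shows "finsum (module_mat TYPE(complex) nr nc) f I \<in> carrier_mat nr nc \<and>
    (\<forall>r<nr. \<forall>c<nc. finsum (module_mat TYPE(complex) nr nc) f I $$ (r, c) = (\<Sum>x\<in>I. f x $$ (r, c)))"
proof -
  let ?M = "module_mat TYPE(complex) nr nc"
  interpret vectorspace "class_ring :: complex ring" ?M by (rule matrix_vs)
  show ?thesis using assms
  proof (induction I rule: finite_induct)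
    case empty
    have "finsum ?M f {} = 0\<^sub>m nr nc" by (simp add: module_mat_simps)
    then show ?case by simp
  next
    case (insert x I)
    have "finsum ?M f (insert x I) = f x + finsum ?M f I"
      using M.finsum_insert[of I x f] insert by (simp add: module_mat_simps Pi_def)
    moreover have "finsum ?M f I \<in> carrier_mat nr nc" using insert by simp
    ultimately show ?case using insert by (auto simp: carrier_matD)
  qed
qed

section \<open>Matrix units, blocks of the Choi matrix and blocks of the ampliation\<close>

lemma matrix_unit_index:
  "r < n \<Longrightarrow> c < n \<Longrightarrow> matrix_unit n i j $$ (r, c) = (if r = i \<and> c = j then 1 else 0)"
  by (simp add: matrix_unit_def)

lemma matrix_unit_carrier [simp]: "matrix_unit n i j \<in> carrier_mat n n"
  by (simp add: matrix_unit_def)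

lemma matrix_unit_dim [simp]: "dim_row (matrix_unit n i j) = n" "dim_col (matrix_unit n i j) = n"
  by (simp_all add: matrix_unit_def)

text \<open>The two conditionals stay separate summands because for \<open>k = l\<close> both apply
  to the same entry.\<close>

lemma matrix_unit_combination_index:
  assumes "x < n" "y < n"
  shows "(p \<cdot>\<^sub>m matrix_unit n k l + q \<cdot>\<^sub>m matrix_unit n l k) $$ (x, y)
    = (if x = k \<and> y = l then p else 0) + (if y = k \<and> x = l then q else 0)"
  using assms
  by (subst index_add_mat; (subst index_smult_mat)?; (subst index_smult_mat)?)
    (simp_all only: matrix_unit_index matrix_unit_dim index_smult_mat if_distrib[of "(*) _"]
      mult_1_right mult_zero_right conj_commute[of "y = k"])

text \<open>In block \<open>(k, l)\<close> only the summand of the matrix unit at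
  \<open>(k, l)\<close> is nonzero.\<close>

lemma
  assumes lin: "linear_on_mat n \<Phi>"
  shows choi_carrier: "choi n \<Phi> \<in> carrier_mat (n * n) (n * n)"
    and choi_index: "\<And>k l a b. k < n \<Longrightarrow> l < n \<Longrightarrow> a < n \<Longrightarrow> b < n \<Longrightarrow>
      choi n \<Phi> $$ (k * n + a, l * n + b) = \<Phi> (matrix_unit n k l) $$ (a, b)"
proof -
  let ?f = "\<lambda>(i, j). kron (matrix_unit n i j) (\<Phi> (matrix_unit n i j))"
  have \<Phi>c: "\<Phi> (matrix_unit n i j) \<in> carrier_mat n n" for i j
    by (rule linear_on_matD(1)[OF lin matrix_unit_carrier])
  have f: "?f p \<in> carrier_mat (n * n) (n * n)" for p
    by (cases p) (simp add: kron_def carrier_matD[OF \<Phi>c] carrier_matD[OF matrix_unit_carrier])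
  note fin = finsum_module_mat[of "{..<n} \<times> {..<n}" ?f "n * n" "n * n", OF _ f, folded choi_def]
  show "choi n \<Phi> \<in> carrier_mat (n * n) (n * n)" using fin by simp
  fix k l a b assume lt: "k < n" "l < n" "a < n" "b < n"
  have "choi n \<Phi> $$ (k * n + a, l * n + b)
      = (\<Sum>p\<in>{..<n} \<times> {..<n}. ?f p $$ (k * n + a, l * n + b))"
    using fin lt by (simp add: encode_less)
  also have "\<dots> = (\<Sum>p\<in>{..<n} \<times> {..<n}. if p = (k, l) then \<Phi> (matrix_unit n k l) $$ (a, b) else 0)"
    using lt
    by (intro sum.cong refl)
      (auto simp: kron_def matrix_unit_index encode_less carrier_matD[OF \<Phi>c]
        carrier_matD[OF matrix_unit_carrier] split: if_splits)
  also have "\<dots> = \<Phi> (matrix_unit n k l) $$ (a, b)" using lt by simp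
  finally show "choi n \<Phi> $$ (k * n + a, l * n + b) = \<Phi> (matrix_unit n k l) $$ (a, b)" .
qed

lemma linear_on_mat_expand:
  assumes lin: "linear_on_mat n \<Phi>" and X: "X \<in> carrier_mat n n" and ab: "a < n" "b < n"
  shows "\<Phi> X $$ (a, b) = (\<Sum>k<n. \<Sum>l<n. X $$ (k, l) * \<Phi> (matrix_unit n k l) $$ (a, b))"
proof -
  \<comment> \<open>\<open>R K\<close> is \<open>X\<close> with all entries outside \<open>K\<close>
    set to zero. Adding a position to \<open>K\<close> adds one multiple of a matrix unit, so
    additivity in two terms suffices for an induction on \<open>K\<close>.\<close>
  define R where "R K = mat n n (\<lambda>p. if p \<in> K then X $$ p else 0)" for K
  have Rc: "R K \<in> carrier_mat n n" for K by (simp add: R_def)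
  note \<Phi>c = linear_on_matD(1)[OF lin]
  have "\<Phi> (R K) $$ (a, b) = (\<Sum>(k, l)\<in>K. X $$ (k, l) * \<Phi> (matrix_unit n k l) $$ (a, b))"
    if "finite K" "K \<subseteq> {..<n} \<times> {..<n}" for K
    using that
  proof (induction K rule: finite_induct)
    case empty
    \<comment> \<open>Writing the zero matrix as a multiple by 0 lets homogeneity show that its
      image is zero.\<close>
    have "R {} = 0 \<cdot>\<^sub>m R {}" by (rule eq_matI) (auto simp: R_def)
    then have "\<Phi> (R {}) = 0 \<cdot>\<^sub>m \<Phi> (R {})" using linear_on_matD(3)[OF lin Rc] by metis
    then have "\<Phi> (R {}) $$ (a, b) = (0 \<cdot>\<^sub>m \<Phi> (R {})) $$ (a, b)" by metis
    also have "\<dots> = 0" using carrier_matD[OF \<Phi>c[OF Rc]] ab by simp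
    finally show ?case by simp
  next
    case (insert p K)
    obtain k l where p: "p = (k, l)" by (cases p)
    have "R (insert p K) = X $$ (k, l) \<cdot>\<^sub>m matrix_unit n k l + R K"
      using insert(2) by (intro eq_matI) (auto simp: R_def p matrix_unit_def)
    then have "\<Phi> (R (insert p K)) = X $$ (k, l) \<cdot>\<^sub>m \<Phi> (matrix_unit n k l) + \<Phi> (R K)"
      using Rc by (simp add: linear_on_matD(2,3)[OF lin])
    then show ?case
      using insert ab carrier_matD[OF \<Phi>c[OF Rc]] carrier_matD[OF \<Phi>c[OF matrix_unit_carrier]]
      by (simp add: p)
  qed
  from this[of "{..<n} \<times> {..<n}"]
  have "\<Phi> (R ({..<n} \<times> {..<n})) $$ (a, b)
      = (\<Sum>k<n. \<Sum>l<n. X $$ (k, l) * \<Phi> (matrix_unit n k l) $$ (a, b))"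
    by (simp add: sum.cartesian_product)
  moreover have "R ({..<n} \<times> {..<n}) = X" using X by (intro eq_matI) (auto simp: R_def)
  ultimately show ?thesis by simp
qed

lemma id_tensor_carrier [simp]: "id_tensor m n \<Phi> X \<in> carrier_mat (m * n) (m * n)"
  by (simp add: id_tensor_def)

lemma id_tensor_index:
  assumes lin: "linear_on_mat n \<Phi>" and lt: "i < m" "j < m" "a < n" "b < n"
  shows "id_tensor m n \<Phi> X $$ (i * n + a, j * n + b)
    = (\<Sum>k<n. \<Sum>l<n. X $$ (i * n + k, j * n + l) * \<Phi> (matrix_unit n k l) $$ (a, b))"
proof -
  have "id_tensor m n \<Phi> X $$ (i * n + a, j * n + b) = \<Phi> (mat_block n X i j) $$ (a, b)"
    using lt by (simp add: id_tensor_def encode_less)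
  also have "\<dots> = (\<Sum>k<n. \<Sum>l<n. mat_block n X i j $$ (k, l) * \<Phi> (matrix_unit n k l) $$ (a, b))"
    by (rule linear_on_mat_expand[OF lin _ lt(3,4)]) (simp add: mat_block_def)
  also have "\<dots> = (\<Sum>k<n. \<Sum>l<n. X $$ (i * n + k, j * n + l) * \<Phi> (matrix_unit n k l) $$ (a, b))"
    by (intro sum.cong refl) (simp add: mat_block_def)
  finally show ?thesis .
qed

text \<open>A matrix unit off the diagonal is not Hermitian, so the hypothesis is applied to
  Hermitian combinations \<open>p \<cdot>\<^sub>m ?E + cnj p \<cdot>\<^sub>m ?F\<close> of a unit
  and its transpose.\<close>

lemma hermiticity_preserving_unit:
  assumes lin: "linear_on_mat n \<Phi>" and hp: "hermiticity_preserving n \<Phi>"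
    and lt: "k < n" "l < n" "a < n" "b < n"
  shows "\<Phi> (matrix_unit n k l) $$ (a, b) = cnj (\<Phi> (matrix_unit n l k) $$ (b, a))"
proof -
  let ?E = "matrix_unit n k l" and ?F = "matrix_unit n l k"
  have \<Phi>c: "\<Phi> (matrix_unit n i j) \<in> carrier_mat n n" for i j
    by (rule linear_on_matD(1)[OF lin matrix_unit_carrier])
  have comb: "\<Phi> (p \<cdot>\<^sub>m ?E + q \<cdot>\<^sub>m ?F) $$ (x, y) = p * \<Phi> ?E $$ (x, y) + q * \<Phi> ?F $$ (x, y)"
    if "x < n" "y < n" for p q x y
    using that carrier_matD[OF \<Phi>c] by (simp add: linear_on_matD(2,3)[OF lin])
  have herm: "\<Phi> (p \<cdot>\<^sub>m ?E + q \<cdot>\<^sub>m ?F) $$ (a, b) = cnj (\<Phi> (p \<cdot>\<^sub>m ?E + q \<cdot>\<^sub>m ?F) $$ (b, a))"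
    if "q = cnj p" for p q
  proof -
    let ?H = "p \<cdot>\<^sub>m ?E + q \<cdot>\<^sub>m ?F"
    have H: "?H \<in> carrier_mat n n" by simp
    have "hermitian_mat ?H"
      unfolding hermitian_mat_iff[OF H]
    proof (intro allI impI)
      fix x y assume xy: "x < n" "y < n"
      show "?H $$ (x, y) = cnj (?H $$ (y, x))"
        unfolding matrix_unit_combination_index[OF xy] matrix_unit_combination_index[OF xy(2,1)] that
        by (simp only: complex_cnj_add complex_cnj_cnj complex_cnj_zero if_distrib[of cnj]
            add.commute conj_commute)
    qed
    then have "hermitian_mat (\<Phi> ?H)" using hp H unfolding hermiticity_preserving_def by blast
    then show ?thesis using hermitian_mat_iff[OF linear_on_matD(1)[OF lin H]] lt by blast
  qed
  let ?x = "\<Phi> ?E $$ (a, b)" and ?y = "\<Phi> ?F $$ (a, b)"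
    and ?z = "\<Phi> ?E $$ (b, a)" and ?w = "\<Phi> ?F $$ (b, a)"
  \<comment> \<open>The choices 1 and \<open>\<i>\<close> for \<open>p\<close> give two equations,
    which are solved for \<open>?x = cnj ?w\<close>.\<close>
  have "?x + ?y = cnj (?z + ?w)" using herm[of 1 1] comb lt by simp
  moreover have "\<i> * ?x - \<i> * ?y = cnj (\<i> * ?z - \<i> * ?w)" using herm[of "-\<i>" \<i>] comb lt by simp
  ultimately show ?thesis by (simp add: complex_eq_iff)
qed

text \<open>In the expansion over matrix units, conjugation exchanges \<open>k\<close> and
  \<open>l\<close> both in the entry of \<open>X\<close> and in the image of the unit.\<close>

lemma id_tensor_hermitian:
  assumes lin: "linear_on_mat n \<Phi>" and hp: "hermiticity_preserving n \<Phi>"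
    and X: "\<And>r c. r < m * n \<Longrightarrow> c < m * n \<Longrightarrow> X $$ (r, c) = cnj (X $$ (c, r))"
    and r: "r < m * n" and c: "c < m * n"
  shows "id_tensor m n \<Phi> X $$ (r, c) = cnj (id_tensor m n \<Phi> X $$ (c, r))"
proof -
  define i a where ia: "i = r div n" "a = r mod n"
  define j b where jb: "j = c div n" "b = c mod n"
  have lt: "i < m" "a < n" "j < m" "b < n" and rc: "r = i * n + a" "c = j * n + b"
    using div_mod_encode[OF r] div_mod_encode[OF c] unfolding ia jb by auto
  have "id_tensor m n \<Phi> X $$ (r, c)
      = (\<Sum>k<n. \<Sum>l<n. X $$ (i * n + k, j * n + l) * \<Phi> (matrix_unit n k l) $$ (a, b))"
    unfolding rc by (rule id_tensor_index[OF lin lt(1,3,2,4)])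
  also have "\<dots> = (\<Sum>k<n. \<Sum>l<n. cnj (X $$ (j * n + l, i * n + k) * \<Phi> (matrix_unit n l k) $$ (b, a)))"
  proof (intro sum.cong refl)
    fix k l assume "k \<in> {..<n}" "l \<in> {..<n}"
    then have kl: "k < n" "l < n" by auto
    show "X $$ (i * n + k, j * n + l) * \<Phi> (matrix_unit n k l) $$ (a, b)
      = cnj (X $$ (j * n + l, i * n + k) * \<Phi> (matrix_unit n l k) $$ (b, a))"
      unfolding complex_cnj_mult
      using X[of "i * n + k" "j * n + l"] hermiticity_preserving_unit[OF lin hp kl lt(2,4)]
        encode_less kl lt by metis
  qed
  also have "\<dots> = cnj (\<Sum>l<n. \<Sum>k<n. X $$ (j * n + l, i * n + k) * \<Phi> (matrix_unit n l k) $$ (b, a))"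
    unfolding cnj_sum by (rule sum.swap)
  also have "\<dots> = cnj (id_tensor m n \<Phi> X $$ (c, r))"
    unfolding rc id_tensor_index[OF lin lt(3,1,4,2)] ..
  finally show ?thesis .
qed

section \<open>Contracting a bipartite matrix with a vector\<close>

text \<open>Read \<open>f\<close> as an \<open>m\<close> by \<open>n\<close> array with entries
  \<open>f (i * n + a)\<close>. The transpose of this matrix is the congruence of \<open>X\<close>
  by the conjugate transpose of that array, acting on the first tensor factor, followed by a swap of
  the factors. Rows of the contraction carry the column index of \<open>X\<close>, as the trace
  pairing with the Choi matrix requires.\<close>

definition contraction :: "nat \<Rightarrow> nat \<Rightarrow> complex mat \<Rightarrow> (nat \<Rightarrow> complex) \<Rightarrow> complex mat" where
  "contraction m n X f = mat (n * n) (n * n) (\<lambda>(r, c). \<Sum>i<m. \<Sum>j<m.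
     X $$ (i * n + c div n, j * n + r div n) * cnj (f (i * n + c mod n)) * f (j * n + r mod n))"

lemma contraction_carrier [simp]: "contraction m n X f \<in> carrier_mat (n * n) (n * n)"
  by (simp add: contraction_def)

lemma contraction_index:
  assumes "k < n" "l < n" "a < n" "b < n"
  shows "contraction m n X f $$ (l * n + b, k * n + a) = (\<Sum>i<m. \<Sum>j<m.
     X $$ (i * n + k, j * n + l) * cnj (f (i * n + a)) * f (j * n + b))"
  using assms by (simp add: contraction_def encode_less)

text \<open>Both sides are the same sum over six indices, since the Choi entry at
  \<open>(k * n + a, l * n + b)\<close> is the entry \<open>(a, b)\<close> of the image of a matrix
  unit. Summing over \<open>i\<close> and \<open>j\<close> first leaves a contraction in which the
  map no longer occurs.\<close>

lemma qform_id_tensor: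
  assumes lin: "linear_on_mat n \<Phi>"
  shows "qform (m * n) (id_tensor m n \<Phi> X) f = mat_trace (choi n \<Phi> * contraction m n X f)"
proof -
  let ?T = "\<lambda>i a j b k l. X $$ (i * n + k, j * n + l) * \<Phi> (matrix_unit n k l) $$ (a, b)
      * f (j * n + b) * cnj (f (i * n + a))"
  have "qform (m * n) (id_tensor m n \<Phi> X) f
    = (\<Sum>i<m. \<Sum>a<n. \<Sum>j<m. \<Sum>b<n. \<Sum>k<n. \<Sum>l<n. ?T i a j b k l)"
    unfolding qform_def sum_encode
    by (intro sum.cong refl) (simp add: id_tensor_index[OF lin] sum_distrib_right)
  also have "\<dots> = (\<Sum>k<n. \<Sum>a<n. \<Sum>l<n. \<Sum>b<n. \<Sum>i<m. \<Sum>j<m. ?T i a j b k l)"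
    unfolding sum.cartesian_product
    \<comment> \<open>The sixfold sum is taken over tuples, so that a single permutation of
      coordinates replaces a chain of exchanges.\<close>
    by (rule sum.reindex_bij_witness[of _ "\<lambda>(k, a, l, b, i, j). (i, a, j, b, k, l)"
          "\<lambda>(i, a, j, b, k, l). (k, a, l, b, i, j)"]) auto
  also have "\<dots> = (\<Sum>k<n. \<Sum>a<n. \<Sum>l<n. \<Sum>b<n.
      choi n \<Phi> $$ (k * n + a, l * n + b) * contraction m n X f $$ (l * n + b, k * n + a))"
    by (intro sum.cong refl)
      (simp add: choi_index[OF lin] contraction_index sum_distrib_left mult_ac)
  also have "\<dots> = (\<Sum>r<n * n. \<Sum>c<n * n. choi n \<Phi> $$ (r, c) * contraction m n X f $$ (c, r))"
    unfolding sum_encode ..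
  also have "\<dots> = mat_trace (choi n \<Phi> * contraction m n X f)"
    by (simp add: mat_trace_def scalar_prod_def lessThan_atLeast0
        carrier_matD[OF choi_carrier[OF lin]] carrier_matD[OF contraction_carrier])
  finally show ?thesis .
qed

text \<open>With \<open>f\<close> and \<open>g\<close> read as arrays, the vector on the right is
  the product of the first with the conjugate transpose of the second. The contraction thus inherits
  nonnegativity from \<open>X\<close>.\<close>

lemma qform_contraction:
  "qform (n * n) (contraction m n X f) g = qform (m * n) X
     (\<lambda>r. \<Sum>b<n. f (r div n * n + b) * cnj (g (r mod n * n + b)))"
proof -
  let ?T = "\<lambda>i k j l a b. X $$ (i * n + k, j * n + l) * (f (j * n + b) * cnj (g (l * n + b)))
      * (cnj (f (i * n + a)) * g (k * n + a))"
  have "qform (n * n) (contraction m n X f) g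
    = (\<Sum>l<n. \<Sum>b<n. \<Sum>k<n. \<Sum>a<n. \<Sum>i<m. \<Sum>j<m. ?T i k j l a b)"
    unfolding qform_def sum_encode
    by (intro sum.cong refl) (simp add: contraction_index sum_distrib_left sum_distrib_right mult_ac)
  also have "\<dots> = (\<Sum>i<m. \<Sum>k<n. \<Sum>j<m. \<Sum>l<n. \<Sum>a<n. \<Sum>b<n. ?T i k j l a b)"
    unfolding sum.cartesian_product
    by (rule sum.reindex_bij_witness[of _ "\<lambda>(i, k, j, l, a, b). (l, b, k, a, i, j)"
          "\<lambda>(l, b, k, a, i, j). (i, k, j, l, a, b)"]) auto
  also have "\<dots> = qform (m * n) X (\<lambda>r. \<Sum>b<n. f (r div n * n + b) * cnj (g (r mod n * n + b)))"
    unfolding qform_def sum_encode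
    by (intro sum.cong refl) (simp add: sum_distrib_right sum_distrib_left cnj_sum)
  finally show ?thesis .
qed

text \<open>Nonnegativity is \<open>qform_contraction\<close>; for Hermitian symmetry, conjugation
  exchanges the summation indices \<open>i\<close> and \<open>j\<close>.\<close>

lemma psd_contraction:
  assumes X: "X \<in> carrier_mat (m * n) (m * n)" "psd X"
  shows "psd (contraction m n X f)"
  unfolding psd_iff[OF contraction_carrier]
proof (intro conjI allI impI)
  fix g show "0 \<le> qform (n * n) (contraction m n X f) g"
    unfolding qform_contraction by (rule psd_qform_nonneg[OF X])
next
  fix r c assume r: "r < n * n" and c: "c < n * n"
  have herm: "X $$ (i * n + k, j * n + l) = cnj (X $$ (j * n + l, i * n + k))"
    if "i < m" "j < m" "k < n" "l < n" for i j k l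
    using that by (intro psd_hermitian[OF X] encode_less)
  define k a where ka: "k = c div n" "a = c mod n"
  define l b where lb: "l = r div n" "b = r mod n"
  have lt: "k < n" "a < n" "l < n" "b < n" and rc: "r = l * n + b" "c = k * n + a"
    using div_mod_encode[OF r] div_mod_encode[OF c] unfolding ka lb by auto
  have "contraction m n X f $$ (r, c)
      = (\<Sum>i<m. \<Sum>j<m. X $$ (i * n + k, j * n + l) * cnj (f (i * n + a)) * f (j * n + b))"
    unfolding rc by (rule contraction_index[OF lt(1,3,2,4)])
  also have "\<dots> = (\<Sum>i<m. \<Sum>j<m.
      cnj (X $$ (j * n + l, i * n + k) * cnj (f (j * n + b)) * f (i * n + a)))"
  proof (intro sum.cong refl)
    fix i j assume "i \<in> {..<m}" "j \<in> {..<m}"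
    then have ij: "i < m" "j < m" by auto
    show "X $$ (i * n + k, j * n + l) * cnj (f (i * n + a)) * f (j * n + b)
        = cnj (X $$ (j * n + l, i * n + k) * cnj (f (j * n + b)) * f (i * n + a))"
      unfolding complex_cnj_mult complex_cnj_cnj herm[OF ij lt(1,3), symmetric]
      by (simp only: mult_ac)
  qed
  also have "\<dots> = cnj (\<Sum>j<m. \<Sum>i<m. X $$ (j * n + l, i * n + k) * cnj (f (j * n + b)) * f (i * n + a))"
    unfolding cnj_sum by (rule sum.swap)
  also have "\<dots> = cnj (contraction m n X f $$ (c, r))"
    unfolding rc contraction_index[OF lt(3,1,4,2)] ..
  finally show "contraction m n X f $$ (r, c) = cnj (contraction m n X f $$ (c, r))" .
qed

text \<open>A negative value at \<open>f\<close> for the second map is a negative trace of its Choi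
  matrix against the contraction. The same contraction serves the first map, so
  \<open>finer_psd\<close> makes the first value negative too.\<close>

lemma id_tensor_psd_of_finer:
  assumes lin: "linear_on_mat n \<Phi>\<^sub>1" "linear_on_mat n \<Phi>\<^sub>2" and hp: "hermiticity_preserving n \<Phi>\<^sub>2"
    and fin: "finer n (choi n \<Phi>\<^sub>1) (choi n \<Phi>\<^sub>2)"
    and X: "X \<in> carrier_mat (m * n) (m * n)" "psd X"
    and psd: "psd (id_tensor m n \<Phi>\<^sub>1 X)"
  shows "psd (id_tensor m n \<Phi>\<^sub>2 X)"
  unfolding psd_iff[OF id_tensor_carrier]
proof (intro conjI allI impI)
  show herm: "id_tensor m n \<Phi>\<^sub>2 X $$ (r, c) = cnj (id_tensor m n \<Phi>\<^sub>2 X $$ (c, r))"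
    if "r < m * n" "c < m * n" for r c
    by (rule id_tensor_hermitian[OF lin(2) hp psd_hermitian[OF X] that])
  fix f
  \<comment> \<open>The order on complex numbers is partial: not being negative yields nonnegativity
    only for a value known to be real.\<close>
  have "Im (qform (m * n) (id_tensor m n \<Phi>\<^sub>2 X) f) = 0" by (rule qform_real[OF herm])
  moreover have "\<not> qform (m * n) (id_tensor m n \<Phi>\<^sub>2 X) f < 0"
  proof
    assume "qform (m * n) (id_tensor m n \<Phi>\<^sub>2 X) f < 0"
    then have "qform (m * n) (id_tensor m n \<Phi>\<^sub>1 X) f < 0"
      unfolding qform_id_tensor[OF lin(1)] qform_id_tensor[OF lin(2)]
      by (rule finer_psd[OF fin choi_carrier[OF lin(1)] choi_carrier[OF lin(2)]
            contraction_carrier psd_contraction[OF X]])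
    moreover have "0 \<le> qform (m * n) (id_tensor m n \<Phi>\<^sub>1 X) f"
      by (rule psd_qform_nonneg[OF id_tensor_carrier psd])
    ultimately show False by simp
  qed
  ultimately show "0 \<le> qform (m * n) (id_tensor m n \<Phi>\<^sub>2 X) f"
    by (simp add: less_eq_complex_def less_complex_def)
qed

lemma nu_admissible_finer:
  assumes "linear_on_mat n \<Phi>\<^sub>1" "linear_on_mat n \<Phi>\<^sub>2" "hermiticity_preserving n \<Phi>\<^sub>2"
    and "finer n (choi n \<Phi>\<^sub>1) (choi n \<Phi>\<^sub>2)" and "nu_admissible n \<Phi>\<^sub>2 m S"
  shows "nu_admissible n \<Phi>\<^sub>1 m S"
  using assms id_tensor_psd_of_finer[OF assms(1-4)]
  unfolding nu_admissible_def density_mat_def by blast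

subsection \<open>Superadditivity of the dimensions\<close>

definition principal_block :: "nat \<Rightarrow> nat \<Rightarrow> complex mat \<Rightarrow> complex mat" where
  "principal_block s M X = mat M M (\<lambda>(r, c). X $$ (s + r, s + c))"

lemma principal_block_carrier [simp]: "principal_block s M X \<in> carrier_mat M M"
  by (simp add: principal_block_def)

lemma sum_shift_extend:
  fixes B :: "nat \<Rightarrow> complex"
  assumes "s + M \<le> N"
  shows "(\<Sum>r<N. B r * (if s \<le> r \<and> r < s + M then g (r - s) else 0)) = (\<Sum>r<M. B (s + r) * g r)"
proof -
  have "(\<Sum>r<N. B r * (if s \<le> r \<and> r < s + M then g (r - s) else 0))
      = (\<Sum>r\<in>{s..<s + M}. B r * g (r - s))"
    using assms by (intro sum.mono_neutral_cong_right) auto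
  also have "\<dots> = (\<Sum>r<M. B (s + r) * g r)"
    by (subst sum.atLeastLessThan_shift_0) (simp add: lessThan_atLeast0)
  finally show ?thesis .
qed

lemma qform_principal_block:
  assumes "s + M \<le> N"
  shows "qform M (principal_block s M X) f
    = qform N X (\<lambda>r. if s \<le> r \<and> r < s + M then f (r - s) else 0)"
proof -
  have cnj_if: "cnj (if P then z else 0) = (if P then cnj z else 0)" for P z by simp
  show ?thesis
    unfolding qform_alt cnj_if sum_shift_extend[OF assms, of _ f]
      sum_shift_extend[OF assms, of _ "\<lambda>i. cnj (f i)"]
    by (intro sum.cong refl) (simp add: principal_block_def)
qed

lemma psd_principal_block:
  assumes X: "X \<in> carrier_mat N N" "psd X" and le: "s + M \<le> N"
  shows "psd (principal_block s M X)"
  unfolding psd_iff[OF principal_block_carrier] qform_principal_block[OF le]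
proof (intro conjI allI impI)
  fix r c assume "r < M" "c < M"
  moreover from this have "X $$ (s + r, s + c) = cnj (X $$ (s + c, s + r))"
    using le by (intro psd_hermitian[OF X]) auto
  ultimately show "principal_block s M X $$ (r, c) = cnj (principal_block s M X $$ (c, r))"
    by (simp add: principal_block_def)
next
  fix f show "0 \<le> qform N X (\<lambda>r. if s \<le> r \<and> r < s + M then f (r - s) else 0)"
    by (rule psd_qform_nonneg[OF X])
qed

text \<open>A vector for the block is padded with zeros to a vector for \<open>X\<close>; the
  block's output is then a window of the output of \<open>X\<close>.\<close>

lemma support_principal_block:
  assumes X: "X \<in> carrier_mat N N" and le: "s + M \<le> N"
    and w: "w \<in> support (principal_block s M X)"
  shows "\<exists>u\<in>support X. w = vec M (\<lambda>i. u $ (s + i))"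
proof -
  obtain v where v: "v \<in> carrier_vec M" "w = principal_block s M X *\<^sub>v v"
    using w by (auto simp: support_def principal_block_def)
  let ?v = "vec N (\<lambda>r. if s \<le> r \<and> r < s + M then v $ (r - s) else 0)"
  have "(X *\<^sub>v ?v) $ (s + i) = w $ i" if "i < M" for i
  proof -
    have "(X *\<^sub>v ?v) $ (s + i)
        = (\<Sum>r<N. X $$ (s + i, r) * (if s \<le> r \<and> r < s + M then v $ (r - s) else 0))"
      using that le X by (simp add: scalar_prod_def lessThan_atLeast0)
    also have "\<dots> = w $ i"
      unfolding sum_shift_extend[OF le, of _ "\<lambda>i. v $ i"] using that v(1)
      by (simp add: v(2) principal_block_def scalar_prod_def lessThan_atLeast0)
    finally show ?thesis .
  qed
  moreover have "dim_vec w = M" using v by (simp add: principal_block_def)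
  ultimately have "w = vec M (\<lambda>i. (X *\<^sub>v ?v) $ (s + i))" by (intro eq_vecI) auto
  moreover have "X *\<^sub>v ?v \<in> support X" using X by (auto simp: support_def)
  ultimately show ?thesis by blast
qed

text \<open>The offset \<open>s * n\<close> is a multiple of the block size, so the blocks of the
  compressed matrix are themselves blocks of \<open>X\<close>, and the map acts on each block
  separately.\<close>

lemma id_tensor_principal_block:
  assumes "s + m \<le> m'"
  shows "id_tensor m n \<Phi> (principal_block (s * n) (m * n) X)
    = principal_block (s * n) (m * n) (id_tensor m' n \<Phi> X)"
proof (rule eq_matI)
  fix r c assume "r < dim_row (principal_block (s * n) (m * n) (id_tensor m' n \<Phi> X))"
    "c < dim_col (principal_block (s * n) (m * n) (id_tensor m' n \<Phi> X))"
  then have r: "r < m * n" and c: "c < m * n" by (auto simp: principal_block_def)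
  have n: "0 < n" using r by (cases n) auto
  have le: "s * n + m * n \<le> m' * n" using assms by (metis add_mult_distrib mult_le_mono1)
  have "mat_block n (principal_block (s * n) (m * n) X) (r div n) (c div n)
      = mat_block n X (s + r div n) (s + c div n)"
    using div_mod_encode(1)[OF r] div_mod_encode(1)[OF c]
    by (intro eq_matI) (auto simp: mat_block_def principal_block_def encode_less add_mult_distrib add.assoc)
  then show "id_tensor m n \<Phi> (principal_block (s * n) (m * n) X) $$ (r, c)
      = principal_block (s * n) (m * n) (id_tensor m' n \<Phi> X) $$ (r, c)"
    using r c n le by (simp add: id_tensor_def principal_block_def)
qed (auto simp: id_tensor_def principal_block_def)

lemma mat_trace_principal_blocks:
  assumes "X \<in> carrier_mat (M + N) (M + N)"
  shows "mat_trace X = mat_trace (principal_block 0 M X) + mat_trace (principal_block M N X)"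
proof -
  have "(\<Sum>i<M + N. X $$ (i, i)) = (\<Sum>i<M. X $$ (i, i)) + (\<Sum>i<N. X $$ (M + i, M + i))"
    by (induction N) (auto simp: add.assoc)
  then show ?thesis using assms by (simp add: mat_trace_def principal_block_def)
qed

text \<open>Admissibility for unnormalised matrices: a nonzero trace could be scaled to 1 without
  enlarging the support or losing positivity of the ampliation. Principal blocks of a density matrix
  need this form, as their traces need not be 1.\<close>

lemma nu_admissible_trace_zero:
  assumes lin: "linear_on_mat n \<Phi>" and adm: "nu_admissible n \<Phi> m S"
    and X: "X \<in> carrier_mat (m * n) (m * n)" "psd X" "support X \<subseteq> S"
    and psd: "psd (id_tensor m n \<Phi> X)"
  shows "mat_trace X = 0"
proof (rule ccontr)
  assume "mat_trace X \<noteq> 0"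
  then obtain t where t: "0 < t" "density_mat (m * n) (complex_of_real t \<cdot>\<^sub>m X)"
    using density_normalise[OF X(1,2)] by blast
  have "support (complex_of_real t \<cdot>\<^sub>m X) \<subseteq> support X"
  proof
    fix w assume "w \<in> support (complex_of_real t \<cdot>\<^sub>m X)"
    then obtain v where v: "v \<in> carrier_vec (m * n)" "w = (complex_of_real t \<cdot>\<^sub>m X) *\<^sub>v v"
      using X(1) by (auto simp: support_def)
    then have "w = X *\<^sub>v (complex_of_real t \<cdot>\<^sub>v v)"
      using X(1) by (intro eq_vecI) (auto simp: scalar_prod_def sum_distrib_left mult_ac)
    then show "w \<in> support X" using X(1) v(1) by (auto simp: support_def)
  qed
  moreover have "psd (id_tensor m n \<Phi> (complex_of_real t \<cdot>\<^sub>m X))"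
    unfolding id_tensor_linear(2)[OF lin X(1) X(1)]
    using psd_smult[OF id_tensor_carrier psd] t(1) by simp
  ultimately show False using adm t(2) X(3) unfolding nu_admissible_def by blast
qed

text \<open>Suppose a density matrix supported in the direct sum has a positive semidefinite
  ampliation. Its two diagonal blocks are supported in \<open>S\<close> and \<open>T\<close>, and
  their ampliations are principal blocks, hence positive semidefinite. Both traces are then 0, yet
  they add up to 1.\<close>

lemma nu_admissible_block_subspace:
  assumes lin: "linear_on_mat n \<Phi>" and S: "nu_admissible n \<Phi> m S" and T: "nu_admissible n \<Phi> k T"
  shows "nu_admissible n \<Phi> (m + k) (block_subspace (m * n) (k * n) S T)"
proof -
  let ?D = "block_subspace (m * n) (k * n) S T"
  have "\<not> psd (id_tensor (m + k) n \<Phi> X)"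
    if X: "density_mat ((m + k) * n) X" "support X \<subseteq> ?D" for X
  proof
    assume psd: "psd (id_tensor (m + k) n \<Phi> X)"
    have Xc: "X \<in> carrier_mat ((m + k) * n) ((m + k) * n)" "psd X" "mat_trace X = 1"
      using X(1) by (auto simp: density_mat_def)
    \<comment> \<open>Both blocks start at a multiple of \<open>n\<close>, as commuting with the
      ampliation requires.\<close>
    let ?X1 = "principal_block (0 * n) (m * n) X" and ?X2 = "principal_block (m * n) (k * n) X"
    have le: "0 * n + m * n \<le> (m + k) * n" "m * n + k * n \<le> (m + k) * n"
      by (auto simp: add_mult_distrib)
    have sub: "u \<in> carrier_vec (m * n + k * n)" "vec_first u (m * n) \<in> S" "vec_last u (k * n) \<in> T"
      if "u \<in> support X" for u
      using that X(2) by (auto simp: block_subspace_def)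
    have "support ?X1 \<subseteq> S"
      using support_principal_block[OF Xc(1) le(1)] sub(2) by (fastforce simp: vec_first_def)
    then have "mat_trace ?X1 = 0"
      using psd_principal_block[OF id_tensor_carrier psd le(1)]
      by (intro nu_admissible_trace_zero[OF lin S _ psd_principal_block[OF Xc(1,2) le(1)]])
        (simp_all add: id_tensor_principal_block[of 0 m "m + k", simplified])
    moreover have "support ?X2 \<subseteq> T"
    proof
      fix w assume "w \<in> support ?X2"
      then obtain u where u: "u \<in> support X" "w = vec (k * n) (\<lambda>i. u $ (m * n + i))"
        using support_principal_block[OF Xc(1) le(2)] by blast
      then show "w \<in> T" using sub(1,3)[OF u(1)] by (simp add: vec_last_def)
    qed
    then have "mat_trace ?X2 = 0"
      using psd_principal_block[OF id_tensor_carrier psd le(2)]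
      by (intro nu_admissible_trace_zero[OF lin T _ psd_principal_block[OF Xc(1,2) le(2)]])
        (simp_all add: id_tensor_principal_block[of m k "m + k"])
    moreover have "mat_trace X = mat_trace ?X1 + mat_trace ?X2"
      using mat_trace_principal_blocks[of X "m * n" "k * n"] Xc(1) by (simp add: add_mult_distrib)
    ultimately show False using Xc(3) by simp
  qed
  then show ?thesis
    using S T block_subspace_subspace[of S "m * n" T "k * n"]
    unfolding nu_admissible_def by (simp add: add_mult_distrib)
qed

section \<open>The maximal dimensions and their limit\<close>

lemma nu_m_eq_dim:
  obtains S where "nu_admissible n \<Phi> m S"
    "nu_m n \<Phi> m = vectorspace.dim class_ring (module_vec TYPE(complex) (m * n)\<lparr>carrier := S\<rparr>)"
proof -
  have "nu_m n \<Phi> m \<in> {vectorspace.dim class_ring (module_vec TYPE(complex) (m * n)\<lparr>carrier := S\<rparr>)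
     | S. nu_admissible n \<Phi> m S}"
    unfolding nu_m_def using nu_set_nonempty nu_set_finite by (intro Max_in) auto
  then show thesis using that by auto
qed

lemma nu_m_superadditive:
  assumes "linear_on_mat n \<Phi>"
  shows "nu_m n \<Phi> m + nu_m n \<Phi> k \<le> nu_m n \<Phi> (m + k)"
proof -
  obtain S where S: "nu_admissible n \<Phi> m S"
    "nu_m n \<Phi> m = vectorspace.dim class_ring (module_vec TYPE(complex) (m * n)\<lparr>carrier := S\<rparr>)"
    by (rule nu_m_eq_dim)
  obtain T where T: "nu_admissible n \<Phi> k T"
    "nu_m n \<Phi> k = vectorspace.dim class_ring (module_vec TYPE(complex) (k * n)\<lparr>carrier := T\<rparr>)"
    by (rule nu_m_eq_dim)
  let ?D = "block_subspace (m * n) (k * n) S T"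
  have "vectorspace.dim class_ring (module_vec TYPE(complex) ((m + k) * n)\<lparr>carrier := ?D\<rparr>)
      \<le> nu_m n \<Phi> (m + k)"
    unfolding nu_m_def using nu_admissible_block_subspace[OF assms S(1) T(1)]
    by (intro Max_ge nu_set_finite) blast
  then show ?thesis
    using block_subspace_dim[of S "m * n" T "k * n"] S T
    by (simp add: nu_admissible_def add_mult_distrib)
qed

text \<open>\<open>nu\<close> is defined by \<open>lim\<close>, which carries information only once
  convergence is known. Fekete's lemma applies with constant \<open>n\<close>, since the ambient
  space has dimension \<open>m * n\<close>.\<close>

lemma nu_LIMSEQ:
  assumes "linear_on_mat n \<Phi>"
  shows "(\<lambda>m. real (nu_m n \<Phi> m) / real m) \<longlonglongrightarrow> nu n \<Phi>"
proof -
  have "nu_m n \<Phi> m \<le> n * m" for m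
  proof -
    obtain S where "nu_admissible n \<Phi> m S"
      "nu_m n \<Phi> m = vectorspace.dim class_ring (module_vec TYPE(complex) (m * n)\<lparr>carrier := S\<rparr>)"
      by (rule nu_m_eq_dim)
    then show ?thesis
      using subspace_fin_dim(2)[of S "m * n"] by (simp add: nu_admissible_def mult.commute)
  qed
  then have "convergent (\<lambda>m. real (nu_m n \<Phi> m) / real m)"
    by (rule superadditive_convergent[OF nu_m_superadditive[OF assms]])
  then show ?thesis unfolding nu_def by (simp add: convergent_LIMSEQ_iff)
qed

text \<open>For each \<open>m\<close> the dimensions for the second map form a subset of those for
  the first, so the maxima compare; the inequality survives the limit because both limits
  exist.\<close>

lemma nu_mono:
  assumes "linear_on_mat n \<Phi>\<^sub>1" and "linear_on_mat n \<Phi>\<^sub>2"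
    and "\<And>m S. nu_admissible n \<Phi>\<^sub>2 m S \<Longrightarrow> nu_admissible n \<Phi>\<^sub>1 m S"
  shows "nu n \<Phi>\<^sub>2 \<le> nu n \<Phi>\<^sub>1"
proof (rule LIMSEQ_le[OF nu_LIMSEQ[OF assms(2)] nu_LIMSEQ[OF assms(1)]], intro exI allI impI)
  fix m
  have "nu_m n \<Phi>\<^sub>2 m \<le> nu_m n \<Phi>\<^sub>1 m"
    unfolding nu_m_def
    using assms(3) nu_set_nonempty nu_set_finite by (intro Max_mono) auto
  then show "real (nu_m n \<Phi>\<^sub>2 m) / real m \<le> real (nu_m n \<Phi>\<^sub>1 m) / real m"
    by (simp add: divide_right_mono)
qed

theorem theorem5:
  fixes n :: nat and \<Phi>\<^sub>1 \<Phi>\<^sub>2 :: "complex mat \<Rightarrow> complex mat"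
  assumes "linear_on_mat n \<Phi>\<^sub>1" and "linear_on_mat n \<Phi>\<^sub>2"
    and "hermiticity_preserving n \<Phi>\<^sub>1" and "hermiticity_preserving n \<Phi>\<^sub>2"
    and "positive_map n \<Phi>\<^sub>1" and "positive_map n \<Phi>\<^sub>2"
    and "\<not> completely_positive n \<Phi>\<^sub>1" and "\<not> completely_positive n \<Phi>\<^sub>2"
    and "finer n (choi n \<Phi>\<^sub>1) (choi n \<Phi>\<^sub>2)"
  shows "nu n \<Phi>\<^sub>1 \<ge> nu n \<Phi>\<^sub>2"
  by (rule nu_mono[OF assms(1,2) nu_admissible_finer[OF assms(1,2,4,9)]])

end
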